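(* Let $P$ be a normal logic program which is locally stratified with corresponding level mapping $l : B_P \to \alpha$, where $\alpha$ is an ordinal. Then $(I_P, d_l)$ is a spherically complete generalized ultrametric space and $\mathrm{GL}_P$ is strictly contracting with respect to $d_l$. If $l$ maps to $\omega$ (i.e. $\alpha = \omega$), then $\mathrm{GL}_P$ is a contraction with respect to the ultrametric $d_l$. Furthermore, in both cases, $\mathrm{GL}_P$ has a unique fixed point and $P$ has a unique stable model.
   Context: A normal logic program $P$ is a finite set of (universally quantified) clauses $A \leftarrow L_1,\ldots,L_n$ with $n \ge 0$, where $A$ (the head) is an atom and the $L_i$ (the body literals) are atoms or negated atoms of a first-order language $\mathcal{L}$ (function symbols allowed). $B_P$ is the set of all ground atoms over $\mathcal{L}$ and $\mathrm{ground}(P)$ is the set of all ground instances over $\mathcal{L}$ of clauses of $P$. $I_P$ is the power set of $B_P$ (the set of interpretations). A program without negation is called definite. For a (possibly infinite) ground definite program $R$, $T_R(I)$ is the set of all $A \in B_P$ for which there is a clause $A \leftarrow A_1,\ldots,A_n$ in $R$ with $A_1,\ldots,A_n \in I$; put $T_R{\uparrow}0=\emptyset$, $T_R{\uparrow}(n+1)=T_R(T_R{\uparrow}n)$, and $\mathrm{fix}(T_R)=\bigcup_{n\in\mathbb{N}} T_R{\uparrow}n$, which is the least fixed point of $T_R$. For $I \in I_P$, the Gelfond-Lifschitz transformation $P/I$ is the definite program consisting of exactly those clauses $A \leftarrow A_1,\ldots,A_n$ for which there is a clause $A \leftarrow A_1,\ldots,A_n,\neg B_1,\ldots,\neg B_m$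 in $\mathrm{ground}(P)$ with $B_1,\ldots,B_m \notin I$. The Gelfond-Lifschitz operator is $\mathrm{GL}_P : I_P \to I_P$, $\mathrm{GL}_P(I) = \mathrm{fix}(T_{P/I})$. A stable model of $P$ is a fixed point of $\mathrm{GL}_P$. A level mapping is a map $l : B_P \to \alpha$ with $\alpha$ an ordinal. $P$ is locally stratified with corresponding level mapping $l$ if for each clause $A \leftarrow A_1,\ldots,A_m,\neg B_1,\ldots,\neg B_n$ in $\mathrm{ground}(P)$ we have $l(A) \ge l(A_i)$ and $l(A) > l(B_j)$ for all $i,j$. $\Gamma_l$ is the set of symbols $2^{-\beta}$ for ordinals $\beta \le \alpha$, ordered by $2^{-\beta} < 2^{-\gamma}$ iff $\gamma < \beta$; its least element $2^{-\alpha}$ is written $0$. For $I \ne J$ in $I_P$, $d_l(I,J) = 2^{-\beta}$ where $\beta$ is the least ordinal such that $I$ and $J$ disagree on some atom of level $\beta$; $d_l(I,I)=0$. For $\alpha=\omega$, $\Gamma_l$ is regarded as a subset of the reals (with $2^{-\omega}=0$), $d_l$ is a real-valued ultrametric, and a contraction is a map $f$ with $d_l(f(x),f(y)) \le \lambda\, d_l(x,y)$ for all $x,y$ and some fixed $\lambda<1$. A generalized ultrametric $d : X\times X \to \Gamma$ ($\Gamma$ an ordered set with least element $0$) satisfies: $d(x,y)=0$ iff $x=y$; $d(x,y)=d(y,x)$; and if $d(x,y)\le\gamma$ and $d(y,z)\le\gamma$ then $d(x,z)\le\gamma$. It is spherically complete if every nonempty chain (under $\subseteq$) of balls $\{y :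 d(x,y)\le\gamma\}$, $x \in X$, $\gamma\in\Gamma$, has nonempty intersection. A map $f$ is strictly contracting with respect to $d$ if $d(f(x),f(y)) < d(x,y)$ for all $x \ne y$. *)

theory Defs
  imports
    "HOL-Analysis.Abstract_Metric_Spaces"
    "HOL-Library.Dual_Ordered_Lattice"
begin

section \<open>First-order languages and normal logic programs\<close>

record ('p, 'f) language =
  fun_syms :: "'f set"
  fun_arity :: "'f \<Rightarrow> nat"
  pred_syms :: "'p set"
  pred_arity :: "'p \<Rightarrow> nat"

datatype ('f, 'v) trm = Var 'v | Fun 'f "('f, 'v) trm list"

datatype ('p, 'f, 'v) atom = Atom 'p "('f, 'v) trm list"

datatype ('p, 'f, 'v) lit = Pos "('p, 'f, 'v) atom" | Neg "('p, 'f, 'v) atom"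

datatype ('p, 'f, 'v) clause =
  Clause (head: "('p, 'f, 'v) atom") (body: "('p, 'f, 'v) lit list")

fun trm_over :: "('p, 'f) language \<Rightarrow> ('f, 'v) trm \<Rightarrow> bool" where
  "trm_over L (Var x) = True"
| "trm_over L (Fun f ts) =
     (f \<in> fun_syms L \<and> length ts = fun_arity L f \<and> (\<forall>t\<in>set ts. trm_over L t))"

fun atom_over :: "('p, 'f) language \<Rightarrow> ('p, 'f, 'v) atom \<Rightarrow> bool" where
  "atom_over L (Atom p ts) =
     (p \<in> pred_syms L \<and> length ts = pred_arity L p \<and> (\<forall>t\<in>set ts. trm_over L t))"

fun lit_atom :: "('p, 'f, 'v) lit \<Rightarrow> ('p, 'f, 'v) atom" where
  "lit_atom (Pos A) = A"
| "lit_atom (Neg A) = A"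

definition clause_over :: "('p, 'f) language \<Rightarrow> ('p, 'f, 'v) clause \<Rightarrow> bool" where
  "clause_over L C \<longleftrightarrow>
     atom_over L (head C) \<and> (\<forall>K\<in>set (body C). atom_over L (lit_atom K))"

definition normal_program :: "('p, 'f) language \<Rightarrow> ('p, 'f, 'v) clause set \<Rightarrow> bool" where
  "normal_program L P \<longleftrightarrow> finite P \<and> (\<forall>C\<in>P. clause_over L C)"

fun vars_trm :: "('f, 'v) trm \<Rightarrow> 'v set" where
  "vars_trm (Var x) = {x}"
| "vars_trm (Fun f ts) = (\<Union>t\<in>set ts. vars_trm t)"

fun vars_atom :: "('p, 'f, 'v) atom \<Rightarrow> 'v set" where
  "vars_atom (Atom p ts) = (\<Union>t\<in>set ts. vars_trm t)"

definition vars_clause :: "('p, 'f, 'v) clause \<Rightarrow> 'v set" where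
  "vars_clause C = vars_atom (head C) \<union> (\<Union>K\<in>set (body C). vars_atom (lit_atom K))"

fun subst_trm :: "('v \<Rightarrow> ('f, 'v) trm) \<Rightarrow> ('f, 'v) trm \<Rightarrow> ('f, 'v) trm" where
  "subst_trm \<sigma> (Var x) = \<sigma> x"
| "subst_trm \<sigma> (Fun f ts) = Fun f (map (subst_trm \<sigma>) ts)"

fun subst_atom :: "('v \<Rightarrow> ('f, 'v) trm) \<Rightarrow> ('p, 'f, 'v) atom \<Rightarrow> ('p, 'f, 'v) atom" where
  "subst_atom \<sigma> (Atom p ts) = Atom p (map (subst_trm \<sigma>) ts)"

fun subst_lit :: "('v \<Rightarrow> ('f, 'v) trm) \<Rightarrow> ('p, 'f, 'v) lit \<Rightarrow> ('p, 'f, 'v) lit" where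
  "subst_lit \<sigma> (Pos A) = Pos (subst_atom \<sigma> A)"
| "subst_lit \<sigma> (Neg A) = Neg (subst_atom \<sigma> A)"

definition subst_clause ::
  "('v \<Rightarrow> ('f, 'v) trm) \<Rightarrow> ('p, 'f, 'v) clause \<Rightarrow> ('p, 'f, 'v) clause" where
  "subst_clause \<sigma> C = Clause (subst_atom \<sigma> (head C)) (map (subst_lit \<sigma>) (body C))"

definition ground_terms :: "('p, 'f) language \<Rightarrow> ('f, 'v) trm set" where
  "ground_terms L = {t. trm_over L t \<and> vars_trm t = {}}"

definition herbrand_base :: "('p, 'f) language \<Rightarrow> ('p, 'f, 'v) atom set" where
  "herbrand_base L = {A. atom_over L A \<and> vars_atom A = {}}"

text \<open>Only the variables occurring in \<open>C\<close> need ground values: if the language has no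
  constants, there are no ground terms at all, yet variable-free clauses are still their own
  ground instances.\<close>

definition ground ::
  "('p, 'f) language \<Rightarrow> ('p, 'f, 'v) clause set \<Rightarrow> ('p, 'f, 'v) clause set" where
  "ground L P =
     {subst_clause \<sigma> C | \<sigma> C. C \<in> P \<and> (\<forall>x\<in>vars_clause C. \<sigma> x \<in> ground_terms L)}"

abbreviation interpretations :: "('p, 'f) language \<Rightarrow> ('p, 'f, 'v) atom set set" where
  "interpretations L \<equiv> Pow (herbrand_base L)"


section \<open>The Gelfond-Lifschitz operator and stable models\<close>

definition imm_conseq :: "('p, 'f) language \<Rightarrow> ('p, 'f, 'v) clause set \<Rightarrow>
    ('p, 'f, 'v) atom set \<Rightarrow> ('p, 'f, 'v) atom set" where
  "imm_conseq L R I =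
     {A \<in> herbrand_base L. \<exists>As. Clause A (map Pos As) \<in> R \<and> set As \<subseteq> I}"

definition fix_conseq :: "('p, 'f) language \<Rightarrow> ('p, 'f, 'v) clause set \<Rightarrow>
    ('p, 'f, 'v) atom set" where
  "fix_conseq L R = (\<Union>n. (imm_conseq L R ^^ n) {})"

text \<open>The literals of a body may be interleaved in any order; these extract the
  \<open>A\<^sub>i\<close> and the \<open>B\<^sub>j\<close>.\<close>

definition pos_body :: "('p, 'f, 'v) clause \<Rightarrow> ('p, 'f, 'v) atom list" where
  "pos_body C = [A. Pos A \<leftarrow> body C]"

definition neg_body :: "('p, 'f, 'v) clause \<Rightarrow> ('p, 'f, 'v) atom list" where
  "neg_body C = [B. Neg B \<leftarrow> body C]"

definition GL_reduct :: "('p, 'f) language \<Rightarrow> ('p, 'f, 'v) clause set \<Rightarrow>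
    ('p, 'f, 'v) atom set \<Rightarrow> ('p, 'f, 'v) clause set" where
  "GL_reduct L P I =
     {Clause (head C) (map Pos (pos_body C)) | C.
        C \<in> ground L P \<and> (\<forall>B\<in>set (neg_body C). B \<notin> I)}"

definition GL :: "('p, 'f) language \<Rightarrow> ('p, 'f, 'v) clause set \<Rightarrow>
    ('p, 'f, 'v) atom set \<Rightarrow> ('p, 'f, 'v) atom set" where
  "GL L P I = fix_conseq L (GL_reduct L P I)"

definition stable_model :: "('p, 'f) language \<Rightarrow> ('p, 'f, 'v) clause set \<Rightarrow>
    ('p, 'f, 'v) atom set \<Rightarrow> bool" where
  "stable_model L P M \<longleftrightarrow> M \<in> interpretations L \<and> GL L P M = M"


section \<open>Level mappings\<close>

text \<open>An ordinal is represented by an element \<open>\<alpha>\<close> of an arbitrary well-ordered type and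
  stands for the order type of \<open>{..<\<alpha>}\<close>; its elements are the \<open>\<beta> < \<alpha>\<close>. Every ordinal
  \<open>\<alpha>\<close> arises this way, for instance as the top element of a type of order type \<open>\<alpha> + 1\<close>.\<close>

definition level_mapping ::
  "('p, 'f) language \<Rightarrow> 'o::wellorder \<Rightarrow> (('p, 'f, 'v) atom \<Rightarrow> 'o) \<Rightarrow> bool" where
  "level_mapping L \<alpha> l \<longleftrightarrow> (\<forall>A\<in>herbrand_base L. l A < \<alpha>)"

definition locally_stratified :: "('p, 'f) language \<Rightarrow> ('p, 'f, 'v) clause set \<Rightarrow>
    'o::wellorder \<Rightarrow> (('p, 'f, 'v) atom \<Rightarrow> 'o) \<Rightarrow> bool" where
  "locally_stratified L P \<alpha> l \<longleftrightarrow>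
     level_mapping L \<alpha> l \<and>
     (\<forall>C\<in>ground L P.
        (\<forall>A\<in>set (pos_body C). l (head C) \<ge> l A) \<and>
        (\<forall>B\<in>set (neg_body C). l (head C) > l B))"

definition is_omega :: "'o::wellorder \<Rightarrow> bool" where
  "is_omega \<alpha> \<longleftrightarrow> (\<exists>f :: nat \<Rightarrow> 'o. strict_mono f \<and> range f = {..<\<alpha>})"


section \<open>Generalized ultrametrics\<close>

definition generalized_ultrametric ::
  "'x set \<Rightarrow> 'g::order set \<Rightarrow> 'g \<Rightarrow> ('x \<Rightarrow> 'x \<Rightarrow> 'g) \<Rightarrow> bool" where
  "generalized_ultrametric X \<Gamma> z d \<longleftrightarrow>
     z \<in> \<Gamma> \<and> (\<forall>\<gamma>\<in>\<Gamma>. z \<le> \<gamma>) \<and>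
     (\<forall>x\<in>X. \<forall>y\<in>X. d x y \<in> \<Gamma>) \<and>
     (\<forall>x\<in>X. \<forall>y\<in>X. d x y = z \<longleftrightarrow> x = y) \<and>
     (\<forall>x\<in>X. \<forall>y\<in>X. d x y = d y x) \<and>
     (\<forall>x\<in>X. \<forall>y\<in>X. \<forall>w\<in>X. \<forall>\<gamma>\<in>\<Gamma>. d x y \<le> \<gamma> \<longrightarrow> d y w \<le> \<gamma> \<longrightarrow> d x w \<le> \<gamma>)"

definition um_balls :: "'x set \<Rightarrow> 'g::order set \<Rightarrow> ('x \<Rightarrow> 'x \<Rightarrow> 'g) \<Rightarrow> 'x set set" where
  "um_balls X \<Gamma> d = {{y \<in> X. d x y \<le> \<gamma>} | x \<gamma>. x \<in> X \<and> \<gamma> \<in> \<Gamma>}"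

definition spherically_complete ::
  "'x set \<Rightarrow> 'g::order set \<Rightarrow> ('x \<Rightarrow> 'x \<Rightarrow> 'g) \<Rightarrow> bool" where
  "spherically_complete X \<Gamma> d \<longleftrightarrow>
     (\<forall>\<C>. subset.chain (um_balls X \<Gamma> d) \<C> \<longrightarrow> \<C> \<noteq> {} \<longrightarrow> \<Inter>\<C> \<noteq> {})"

definition strictly_contracting ::
  "'x set \<Rightarrow> ('x \<Rightarrow> 'x \<Rightarrow> 'g::order) \<Rightarrow> ('x \<Rightarrow> 'x) \<Rightarrow> bool" where
  "strictly_contracting X d f \<longleftrightarrow>
     f ` X \<subseteq> X \<and> (\<forall>x\<in>X. \<forall>y\<in>X. x \<noteq> y \<longrightarrow> d (f x) (f y) < d x y)"

definition ultrametric :: "'x set \<Rightarrow> ('x \<Rightarrow> 'x \<Rightarrow> real) \<Rightarrow> bool" where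
  "ultrametric X d \<longleftrightarrow>
     Metric_space X d \<and> (\<forall>x\<in>X. \<forall>y\<in>X. \<forall>w\<in>X. d x w \<le> max (d x y) (d y w))"

definition contraction :: "'x set \<Rightarrow> ('x \<Rightarrow> 'x \<Rightarrow> real) \<Rightarrow> ('x \<Rightarrow> 'x) \<Rightarrow> bool" where
  "contraction X d f \<longleftrightarrow>
     f ` X \<subseteq> X \<and> (\<exists>c<1. \<forall>x\<in>X. \<forall>y\<in>X. d (f x) (f y) \<le> c * d x y)"


section \<open>The distance induced by a level mapping\<close>

text \<open>The symbol \<open>2\<close> to the power \<open>-\<beta>\<close> is \<open>dual \<beta>\<close>: the order of
  the type \<open>'o dual\<close> is the reverse of that of \<open>'o\<close>. The least element \<open>0\<close> of
  \<open>level_dists \<alpha>\<close> is \<open>dual \<alpha>\<close>.\<close>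

definition level_dists :: "'o::wellorder \<Rightarrow> 'o dual set" where
  "level_dists \<alpha> = {dual \<beta> | \<beta>. \<beta> \<le> \<alpha>}"

definition level_dist :: "('p, 'f) language \<Rightarrow> 'o::wellorder \<Rightarrow> (('p, 'f, 'v) atom \<Rightarrow> 'o) \<Rightarrow>
    ('p, 'f, 'v) atom set \<Rightarrow> ('p, 'f, 'v) atom set \<Rightarrow> 'o dual" where
  "level_dist L \<alpha> l I J =
     (if I = J then dual \<alpha>
      else dual (LEAST \<beta>. \<exists>A\<in>herbrand_base L. l A = \<beta> \<and> (A \<in> I \<longleftrightarrow> A \<notin> J)))"

text \<open>The real reading of these symbols for \<open>\<alpha> = \<omega>\<close>. A \<open>\<beta> < \<alpha>\<close> is then the
  natural number \<open>card {..<\<beta>}\<close>.\<close>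

definition real_of_level_dist :: "'o::wellorder \<Rightarrow> 'o dual \<Rightarrow> real" where
  "real_of_level_dist \<alpha> \<gamma> = (if undual \<gamma> = \<alpha> then 0 else (1 / 2) ^ card {..<undual \<gamma>})"

definition real_level_dist :: "('p, 'f) language \<Rightarrow> 'o::wellorder \<Rightarrow>
    (('p, 'f, 'v) atom \<Rightarrow> 'o) \<Rightarrow> ('p, 'f, 'v) atom set \<Rightarrow> ('p, 'f, 'v) atom set \<Rightarrow> real" where
  "real_level_dist L \<alpha> l I J = real_of_level_dist \<alpha> (level_dist L \<alpha> l I J)"

end

theory Submission
  imports Defs
begin

text \<open>
  Two interpretations are at distance at most \<open>2\<^sup>-\<^sup>\<gamma>\<close> iff they agree on all atoms of level below
  \<open>\<gamma>\<close>. A chain of balls therefore prescribes compatible initial segments of an interpretation,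
  whose union lies in every ball. If \<open>I\<close> and \<open>J\<close> agree below \<open>\<beta>\<close>, then a derivation of an atom of
  level at most \<open>\<beta>\<close> in \<open>P/I\<close> only meets atoms of level at most \<open>\<beta>\<close> and negated atoms of level
  below \<open>\<beta>\<close>, so it is also a derivation in \<open>P/J\<close>; hence the images agree up to and including level
  \<open>\<beta>\<close>. The fixed point is the one of the theorem of Priess-Crampe and Ribenboim: by Zorn's lemma
  there is a minimal ball among those centred at some \<open>x\<close> with radius \<open>d(x, f(x))\<close>, and its centre is
  fixed, since the ball of \<open>f(x)\<close> is strictly smaller than that of any non-fixed \<open>x\<close>.
\<close>

section \<open>Fixed points in generalized ultrametric spaces\<close>

lemma strictly_contracting_has_fixed_point:
  fixes d :: "'x \<Rightarrow> 'x \<Rightarrow> 'g::order"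
  assumes um: "generalized_ultrametric X \<Gamma> z d" and sc: "spherically_complete X \<Gamma> d"
    and f: "strictly_contracting X d f" and ne: "X \<noteq> {}"
  shows "\<exists>x\<in>X. f x = x"
proof -
  have \<Gamma>: "\<forall>x\<in>X. \<forall>y\<in>X. d x y \<in> \<Gamma>"
    and sym: "\<forall>x\<in>X. \<forall>y\<in>X. d x y = d y x"
    and zero: "\<forall>\<gamma>\<in>\<Gamma>. z \<le> \<gamma>" "\<forall>x\<in>X. \<forall>y\<in>X. d x y = z \<longleftrightarrow> x = y"
    and ultra: "\<forall>x\<in>X. \<forall>y\<in>X. \<forall>w\<in>X. \<forall>\<gamma>\<in>\<Gamma>. d x y \<le> \<gamma> \<longrightarrow> d y w \<le> \<gamma> \<longrightarrow> d x w \<le> \<gamma>"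
    using um unfolding generalized_ultrametric_def by - (elim conjE, assumption)+
  note \<Gamma> = \<Gamma>[rule_format] and sym = sym[rule_format] and ultra = ultra[rule_format]
  have refl: "d x x \<le> \<gamma>" if "x \<in> X" "\<gamma> \<in> \<Gamma>" for x \<gamma>
    using zero(1)[rule_format, of \<gamma>] zero(2)[rule_format, of x x] that by simp
  have fX: "f x \<in> X" if "x \<in> X" for x
    using f that unfolding strictly_contracting_def by blast
  have strict: "d (f x) (f y) < d x y" if "x \<in> X" "y \<in> X" "x \<noteq> y" for x y
    using f that unfolding strictly_contracting_def by blast
  have weak: "d (f x) (f y) \<le> d x y" if "x \<in> X" "y \<in> X" for x y
    using strict[OF that] refl[OF fX \<Gamma>] that by (cases "x = y") (simp_all add: less_imp_le)
  \<comment> \<open>With the displacement \<open>d x (f x)\<close> as radius, the ball around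
    \<open>x\<close> also contains \<open>f x\<close>.\<close>
  define B where "B x = {y \<in> X. d x y \<le> d x (f x)}" for x
  have ball: "B x \<in> um_balls X \<Gamma> d" if "x \<in> X" for x
    using that \<Gamma> fX unfolding um_balls_def B_def by blast
  have center: "x \<in> B x" if "x \<in> X" for x
    using refl \<Gamma> fX that unfolding B_def by blast
  \<comment> \<open>For \<open>y\<close> in \<open>B x\<close>, \<open>f y\<close> is at least as
    close to \<open>f x\<close> as \<open>y\<close> is to \<open>x\<close>. So \<open>x\<close>,
    \<open>f x\<close>, \<open>y\<close> and \<open>f y\<close> lie within \<open>d x (f x)\<close>
    of one another, which bounds the displacement of \<open>y\<close>.\<close>
  have mono: "B y \<subseteq> B x" if "x \<in> X" "y \<in> B x" for x y
  proof
    fix w assume w: "w \<in> B y"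
    have X: "y \<in> X" "w \<in> X" and xy: "d x y \<le> d x (f x)"
      using that w by (auto simp: B_def)
    have g: "d x (f x) \<in> \<Gamma>" using \<Gamma> fX that(1) by blast
    have "d (f x) (f y) \<le> d x (f x)" using weak[OF that(1) X(1)] xy by simp
    then have "d x (f y) \<le> d x (f x)"
      using ultra[of x "f x" "f y" "d x (f x)"] that(1) fX[OF that(1)] fX[OF X(1)] g by simp
    then have "d y (f y) \<le> d x (f x)"
      using ultra[of y x "f y" "d x (f x)"] sym[of x y] that(1) X fX[OF X(1)] g xy by simp
    then have "d y w \<le> d x (f x)" using w unfolding B_def by auto
    then show "w \<in> B x"
      using ultra[of x y w "d x (f x)"] that(1) X g xy unfolding B_def by simp
  qed
  \<comment> \<open>Inclusion is reversed, so a maximal element in Zorn's lemma is a minimal ball. A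
    point \<open>y\<close> common to a chain gives the bound \<open>B y\<close>, by
    \<open>mono\<close>.\<close>
  have "\<exists>m\<in>B ` X. \<forall>b\<in>B ` X. b \<subseteq> m \<longrightarrow> b = m"
  proof (rule predicate_Zorn)
    show "partial_order_on (B ` X) (relation_of (\<lambda>a b. b \<subseteq> a) (B ` X))"
      by (rule partial_order_on_relation_ofI) auto
  next
    fix C assume C: "C \<in> Chains (relation_of (\<lambda>a b. b \<subseteq> a) (B ` X))"
    have CB: "C \<subseteq> B ` X" using C unfolding Chains_def relation_of_def by blast
    have chain: "subset.chain (um_balls X \<Gamma> d) C"
      using C CB ball unfolding Chains_def relation_of_def subset_chain_def by blast
    show "\<exists>u\<in>B ` X. \<forall>a\<in>C. u \<subseteq> a"
    proof (cases "C = {}")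
      \<comment> \<open>The empty chain still needs some ball as bound; this is where
        \<open>X\<close> must be nonempty.\<close>
      case True
      then show ?thesis using ne by blast
    next
      case False
      then obtain y where y: "y \<in> \<Inter>C"
        using sc chain unfolding spherically_complete_def by blast
      then have "y \<in> X" using False CB unfolding B_def by blast
      moreover have "B y \<subseteq> a" if "a \<in> C" for a
        using mono CB y that by blast
      ultimately show ?thesis by blast
    qed
  qed
  then obtain x where x: "x \<in> X" and min: "\<forall>y\<in>X. B y \<subseteq> B x \<longrightarrow> B y = B x"
    by auto
  have "f x = x"
  proof (rule ccontr)
    assume neq: "f x \<noteq> x"
    have "f x \<in> B x" using x fX unfolding B_def by blast
    \<comment> \<open>Minimality puts \<open>x\<close> into the ball of \<open>f x\<close>, so
      \<open>f x\<close> is displaced at least as far as \<open>x\<close>, against strict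
      contraction.\<close>
    then have "B (f x) = B x" using min mono[OF x] fX[OF x] by simp
    then have "x \<in> B (f x)" using center x by blast
    then have "d x (f x) \<le> d (f x) (f (f x))"
      using sym[of x "f x"] x fX unfolding B_def by simp
    then show False using strict[OF x fX[OF x]] neq by simp
  qed
  then show ?thesis using x by blast
qed

lemma strictly_contracting_fixed_point_unique:
  assumes "strictly_contracting X d f" "x \<in> X" "y \<in> X" "f x = x" "f y = y"
  shows "x = y"
  using assms unfolding strictly_contracting_def by (metis less_irrefl)

section \<open>The level distance\<close>

text \<open>Since \<open>dual\<close> reverses the order, the left side bounds the least level of
  disagreement from below by \<open>\<gamma>\<close>. The bound
  \<open>\<gamma> \<le> \<alpha>\<close> settles the case \<open>I = J\<close>, where the distance
  is \<open>dual \<alpha>\<close>.\<close>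

lemma level_dist_le_iff:
  assumes "I \<in> interpretations L" "J \<in> interpretations L" "\<gamma> \<le> \<alpha>"
  shows "level_dist L \<alpha> l I J \<le> dual \<gamma> \<longleftrightarrow>
    (\<forall>A\<in>herbrand_base L. l A < \<gamma> \<longrightarrow> (A \<in> I \<longleftrightarrow> A \<in> J))"
proof (cases "I = J")
  case True
  then show ?thesis using assms by (simp add: level_dist_def dual_less_eq_iff)
next
  case False
  let ?D = "\<lambda>\<beta>. \<exists>A\<in>herbrand_base L. l A = \<beta> \<and> (A \<in> I \<longleftrightarrow> A \<notin> J)"
  have "\<exists>\<beta>. ?D \<beta>" using False assms by blast
  then have D: "?D (Least ?D)" by (rule LeastI_ex)
  have "\<gamma> \<le> Least ?D \<longleftrightarrow> (\<forall>\<beta>. ?D \<beta> \<longrightarrow> \<gamma> \<le> \<beta>)"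
    using D Least_le[of ?D] by (meson order_trans)
  also have "\<dots> \<longleftrightarrow> (\<forall>A\<in>herbrand_base L. \<not> l A < \<gamma> \<or> \<not> (A \<in> I \<longleftrightarrow> A \<notin> J))"
    unfolding not_less by blast
  finally show ?thesis using False by (simp only: level_dist_def if_False less_eq_dual_iff) blast
qed

text \<open>The least level of disagreement is attained at an atom of the Herbrand base, so distinct
  interpretations never receive the value \<open>dual \<alpha>\<close> that stands for 0.\<close>

lemma level_dist_cases:
  assumes "level_mapping L \<alpha> l" "I \<in> interpretations L" "J \<in> interpretations L" "I \<noteq> J"
  obtains \<beta> where "\<beta> < \<alpha>" "level_dist L \<alpha> l I J = dual \<beta>"
proof -
  let ?D = "\<lambda>\<beta>. \<exists>A\<in>herbrand_base L. l A = \<beta> \<and> (A \<in> I \<longleftrightarrow> A \<notin> J)"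
  have "\<exists>\<beta>. ?D \<beta>" using assms by blast
  then have "?D (Least ?D)" by (rule LeastI_ex)
  then have "Least ?D < \<alpha>" using assms(1) unfolding level_mapping_def by auto
  then show thesis using that assms(4) by (simp add: level_dist_def)
qed

lemma level_dist_commute: "level_dist L \<alpha> l I J = level_dist L \<alpha> l J I"
proof -
  have "(A \<in> I \<longleftrightarrow> A \<notin> J) \<longleftrightarrow> (A \<in> J \<longleftrightarrow> A \<notin> I)" for A by blast
  then show ?thesis unfolding level_dist_def by (simp add: eq_commute)
qed

lemma level_dist_eq_zero_iff:
  assumes "level_mapping L \<alpha> l" "I \<in> interpretations L" "J \<in> interpretations L"
  shows "level_dist L \<alpha> l I J = dual \<alpha> \<longleftrightarrow> I = J"
proof (cases "I = J")
  case False
  then show ?thesis using level_dist_cases[OF assms] by (metis eq_dual_iff less_irrefl)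
qed (simp add: level_dist_def)

lemma level_dist_in_level_dists:
  assumes "level_mapping L \<alpha> l" "I \<in> interpretations L" "J \<in> interpretations L"
  shows "level_dist L \<alpha> l I J \<in> level_dists \<alpha>"
proof (cases "I = J")
  case True
  then show ?thesis by (auto simp: level_dist_def level_dists_def)
next
  case False
  then show ?thesis
    using level_dist_cases[OF assms] unfolding level_dists_def
    by (metis (mono_tags, lifting) less_imp_le mem_Collect_eq)
qed

text \<open>Agreement below a fixed level is transitive.\<close>

lemma level_dist_ultra:
  assumes "I \<in> interpretations L" "J \<in> interpretations L" "K \<in> interpretations L"
    and "\<gamma> \<in> level_dists \<alpha>" "level_dist L \<alpha> l I J \<le> \<gamma>" "level_dist L \<alpha> l J K \<le> \<gamma>"
  shows "level_dist L \<alpha> l I K \<le> \<gamma>"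
proof -
  obtain \<beta> where "\<gamma> = dual \<beta>" "\<beta> \<le> \<alpha>" using assms(4) unfolding level_dists_def by blast
  then show ?thesis using assms by (simp add: level_dist_le_iff)
qed

lemma generalized_ultrametric_level_dist:
  assumes "level_mapping L \<alpha> l"
  shows "generalized_ultrametric (interpretations L) (level_dists \<alpha>) (dual \<alpha>) (level_dist L \<alpha> l)"
  unfolding generalized_ultrametric_def
proof (intro conjI ballI impI)
  show "dual \<alpha> \<in> level_dists \<alpha>" unfolding level_dists_def by blast
  show "dual \<alpha> \<le> \<gamma>" if "\<gamma> \<in> level_dists \<alpha>" for \<gamma>
    using that unfolding level_dists_def by (auto simp: dual_less_eq_iff)
qed (simp_all only: assms level_dist_in_level_dists level_dist_eq_zero_iff
    level_dist_commute[of L \<alpha> l], erule (5) level_dist_ultra)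

lemma spherically_complete_level_dist:
  "spherically_complete (interpretations L) (level_dists \<alpha>) (level_dist L \<alpha> l)"
  unfolding spherically_complete_def
proof (intro allI impI)
  fix \<C> assume chain: "subset.chain (um_balls (interpretations L) (level_dists \<alpha>) (level_dist L \<alpha> l)) \<C>"
  \<comment> \<open>Each ball is recoded as a centre and a level below which its members must copy
    the centre; two applications of choice then fix these as \<open>c b\<close> and
    \<open>r b\<close>.\<close>
  have "\<forall>b\<in>\<C>. \<exists>I \<gamma>. I \<in> interpretations L \<and> (\<forall>J. J \<in> b \<longleftrightarrow> J \<in> interpretations L \<and>
      (\<forall>A\<in>herbrand_base L. l A < \<gamma> \<longrightarrow> (A \<in> I \<longleftrightarrow> A \<in> J)))"
  proof
    fix b assume "b \<in> \<C>"
    then have "b \<in> um_balls (interpretations L) (level_dists \<alpha>) (level_dist L \<alpha> l)"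
      using chain unfolding subset_chain_def by blast
    then obtain I \<gamma> where I: "I \<in> interpretations L" and "\<gamma> \<le> \<alpha>"
      and b: "b = {J \<in> interpretations L. level_dist L \<alpha> l I J \<le> dual \<gamma>}"
      unfolding um_balls_def level_dists_def by blast
    then have "J \<in> b \<longleftrightarrow> J \<in> interpretations L \<and>
        (\<forall>A\<in>herbrand_base L. l A < \<gamma> \<longrightarrow> (A \<in> I \<longleftrightarrow> A \<in> J))" for J
      using level_dist_le_iff[of I L J \<gamma> \<alpha> l] by auto
    then show "\<exists>I \<gamma>. I \<in> interpretations L \<and> (\<forall>J. J \<in> b \<longleftrightarrow> J \<in> interpretations L \<and>
        (\<forall>A\<in>herbrand_base L. l A < \<gamma> \<longrightarrow> (A \<in> I \<longleftrightarrow> A \<in> J)))" using I by blast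
  qed
  from bchoice[OF this] obtain c where "\<forall>b\<in>\<C>. \<exists>\<gamma>. c b \<in> interpretations L \<and>
      (\<forall>J. J \<in> b \<longleftrightarrow> J \<in> interpretations L \<and>
        (\<forall>A\<in>herbrand_base L. l A < \<gamma> \<longrightarrow> (A \<in> c b \<longleftrightarrow> A \<in> J)))" ..
  from bchoice[OF this] obtain r where cr: "\<forall>b\<in>\<C>. c b \<in> interpretations L \<and>
      (\<forall>J. J \<in> b \<longleftrightarrow> J \<in> interpretations L \<and>
        (\<forall>A\<in>herbrand_base L. l A < r b \<longrightarrow> (A \<in> c b \<longleftrightarrow> A \<in> J)))" ..
  have c: "c b \<in> interpretations L" if "b \<in> \<C>" for b
    using bspec[OF cr that] by (rule conjunct1)
  have mem: "J \<in> b \<longleftrightarrow> J \<in> interpretations L \<and>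
      (\<forall>A\<in>herbrand_base L. l A < r b \<longrightarrow> (A \<in> c b \<longleftrightarrow> A \<in> J))" if "b \<in> \<C>" for b J
    using bspec[OF cr that, THEN conjunct2] by (rule spec)
  \<comment> \<open>The prescribed parts are glued together; atoms that no ball prescribes are left
    false.\<close>
  define M where "M = {A \<in> herbrand_base L. \<exists>b\<in>\<C>. l A < r b \<and> A \<in> c b}"
  have M: "M \<in> interpretations L" unfolding M_def by blast
  have "M \<in> b" if b: "b \<in> \<C>" for b
  proof -
    \<comment> \<open>Of two nested balls, the larger contains both centres. Hence the centres agree
      on \<open>A\<close>, whose level is below both bounds.\<close>
    have "A \<in> c b"
      if A: "A \<in> herbrand_base L" "l A < r b" and b': "b' \<in> \<C>" "l A < r b'" "A \<in> c b'" for A b'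
    proof -
      have "c b \<in> b" "c b' \<in> b'" using mem c b b'(1) by simp_all
      moreover have "b \<subseteq> b' \<or> b' \<subseteq> b" using chain b b' unfolding subset_chain_def by blast
      ultimately have "c b \<in> b' \<or> c b' \<in> b" by blast
      then show ?thesis using mem[OF b] mem[OF b'(1)] A b' by blast
    qed
    then show ?thesis using M mem[OF b] b unfolding M_def by blast
  qed
  then show "\<Inter>\<C> \<noteq> {}" by blast
qed

section \<open>Contractivity of the Gelfond-Lifschitz operator\<close>

lemma GL_in_interpretations: "GL L P I \<in> interpretations L"
proof -
  have "(imm_conseq L R ^^ n) {} \<subseteq> herbrand_base L" for R :: "('a, 'b, 'c) clause set" and n
    by (cases n) (auto simp: imm_conseq_def)
  then show ?thesis unfolding GL_def fix_conseq_def by blast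
qed

lemma imm_conseq_GL_reduct_iff:
  "A \<in> imm_conseq L (GL_reduct L P I) X \<longleftrightarrow> A \<in> herbrand_base L \<and>
    (\<exists>C\<in>ground L P. head C = A \<and> set (neg_body C) \<inter> I = {} \<and> set (pos_body C) \<subseteq> X)"
proof -
  \<comment> \<open>Injectivity of \<open>Pos\<close> identifies the atoms \<open>As\<close> read
    off a reduct clause with the \<open>pos_body\<close> of the ground clause behind it.\<close>
  have "map Pos As = map Pos Bs \<longleftrightarrow> As = Bs" for As Bs :: "('a, 'b, 'c) atom list"
    by (rule inj_map_eq_map) (simp add: inj_def)
  then show ?thesis unfolding imm_conseq_def GL_reduct_def by fastforce
qed

text \<open>By induction on the stage, each derivation step in one reduct is repeated in the other.
  The gain from below \<open>\<beta>\<close> to \<open>\<beta>\<close> itself comes from the strict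
  drop in level at negated atoms.\<close>

lemma GL_level_mono:
  assumes strat: "locally_stratified L P \<alpha> l" and J: "J \<in> interpretations L"
    and agree: "\<And>A. A \<in> herbrand_base L \<Longrightarrow> l A < \<beta> \<Longrightarrow> A \<in> I \<longleftrightarrow> A \<in> J"
    and A: "A \<in> GL L P I" "l A \<le> \<beta>"
  shows "A \<in> GL L P J"
proof -
  have "A \<in> (imm_conseq L (GL_reduct L P J) ^^ n) {}"
    if "A \<in> (imm_conseq L (GL_reduct L P I) ^^ n) {}" "l A \<le> \<beta>" for n A
    using that
  proof (induction n arbitrary: A)
    case (Suc n)
    then obtain C where AH: "A \<in> herbrand_base L" and C: "C \<in> ground L P" "head C = A"
      and neg: "set (neg_body C) \<inter> I = {}"
      and pos: "set (pos_body C) \<subseteq> (imm_conseq L (GL_reduct L P I) ^^ n) {}"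
      by (auto simp: imm_conseq_GL_reduct_iff)
    have "\<forall>B\<in>set (neg_body C). l B < \<beta>" "\<forall>B\<in>set (pos_body C). l B \<le> \<beta>"
      using strat C Suc.prems(2) unfolding locally_stratified_def by fastforce+
    \<comment> \<open>A negated atom in \<open>J\<close> would lie in the Herbrand base, so
      \<open>agree\<close> would put it into \<open>I\<close>, contradicting \<open>neg\<close>. The
      positive atoms have level at most \<open>\<beta>\<close>, so the induction hypothesis covers
      them.\<close>
    then have "set (neg_body C) \<inter> J = {}"
      and "set (pos_body C) \<subseteq> (imm_conseq L (GL_reduct L P J) ^^ n) {}"
      using agree J neg pos Suc.IH by blast+
    then show ?case using AH C by (auto simp: imm_conseq_GL_reduct_iff)
  qed simp
  then show ?thesis using A unfolding GL_def fix_conseq_def by blast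
qed

lemma strictly_contracting_GL:
  fixes L :: "('p, 'f) language" and P :: "('p, 'f, 'v) clause set"
  assumes strat: "locally_stratified L P \<alpha> l"
  shows "strictly_contracting (interpretations L) (level_dist L \<alpha> l) (GL L P)"
  unfolding strictly_contracting_def
proof (intro conjI ballI impI)
  show "GL L P ` interpretations L \<subseteq> interpretations L" using GL_in_interpretations by blast
  fix I J :: "('p, 'f, 'v) atom set"
  assume I: "I \<in> interpretations L" and J: "J \<in> interpretations L" and "I \<noteq> J"
  have lm: "level_mapping L \<alpha> l" using strat unfolding locally_stratified_def by blast
  obtain \<beta> where \<beta>: "\<beta> < \<alpha>" "level_dist L \<alpha> l I J = dual \<beta>"
    using level_dist_cases[OF lm I J \<open>I \<noteq> J\<close>] .
  have agree: "A \<in> I \<longleftrightarrow> A \<in> J" if "A \<in> herbrand_base L" "l A < \<beta>" for A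
    using level_dist_le_iff[OF I J, of \<beta> \<alpha> l] \<beta> that by auto
  \<comment> \<open>Agreement is symmetric in \<open>I\<close> and \<open>J\<close>, so the
    one-sided lemma applies in both directions.\<close>
  have GL: "A \<in> GL L P I \<longleftrightarrow> A \<in> GL L P J" if "l A \<le> \<beta>" for A
    using GL_level_mono[OF strat J agree] GL_level_mono[OF strat I agree[symmetric]] that by blast
  show "level_dist L \<alpha> l (GL L P I) (GL L P J) < level_dist L \<alpha> l I J"
  proof (cases "GL L P I = GL L P J")
    case True
    then show ?thesis using \<beta> by (simp add: level_dist_def dual_less_iff)
  next
    case False
    let ?D = "\<lambda>\<beta>. \<exists>A\<in>herbrand_base L. l A = \<beta> \<and> (A \<in> GL L P I \<longleftrightarrow> A \<notin> GL L P J)"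
    have "\<exists>\<beta>. ?D \<beta>"
      using False GL_in_interpretations[of L P I] GL_in_interpretations[of L P J] by blast
    then have "?D (Least ?D)" by (rule LeastI_ex)
    \<comment> \<open>The images agree up to and including \<open>\<beta>\<close>, so their first
      disagreement comes strictly later.\<close>
    then have "\<beta> < Least ?D" using GL by (metis leI)
    then show ?thesis using False \<beta> by (simp add: level_dist_def dual_less_iff)
  qed
qed

section \<open>Real-valued distances\<close>

text \<open>This makes \<open>card\<close> give the true exponent in
  \<open>real_of_level_dist\<close>; on an infinite set it would return its default 0.\<close>

lemma is_omega_finite_lessThan:
  assumes "is_omega \<alpha>" "\<beta> < \<alpha>"
  shows "finite {..<\<beta>}"
proof -
  obtain f :: "nat \<Rightarrow> 'a" where f: "strict_mono f" "range f = {..<\<alpha>}"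
    using assms(1) unfolding is_omega_def by blast
  then obtain n where n: "\<beta> = f n" using assms(2) by (metis imageE lessThan_iff)
  have "{..<\<beta>} \<subseteq> f ` {..<n}"
  proof
    fix x assume x: "x \<in> {..<\<beta>}"
    then obtain m where "x = f m" using f(2) assms(2) by (metis imageE lessThan_iff order_less_trans)
    then show "x \<in> f ` {..<n}" using x n f(1) by (simp add: strict_mono_less)
  qed
  then show ?thesis using finite_surj by blast
qed

text \<open>For \<omega>, a strictly smaller nonzero distance has an exponent larger by at least
  one. This is the source of the uniform contraction factor.\<close>

lemma real_of_level_dist_halves:
  assumes "is_omega \<alpha>" "\<gamma> \<in> level_dists \<alpha>" "\<delta> \<in> level_dists \<alpha>" "\<gamma> < \<delta>"
  shows "real_of_level_dist \<alpha> \<gamma> \<le> 1 / 2 * real_of_level_dist \<alpha> \<delta>"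
proof -
  have lt: "undual \<delta> < undual \<gamma>" "undual \<gamma> \<le> \<alpha>"
    using assms unfolding level_dists_def by (auto simp: dual_less_iff)
  show ?thesis
  proof (cases "undual \<gamma> = \<alpha>")
    case True
    then show ?thesis by (simp add: real_of_level_dist_def)
  next
    case False
    then have "finite {..<undual \<gamma>}" using is_omega_finite_lessThan[OF assms(1)] lt(2) by simp
    then have "card {..<undual \<delta>} < card {..<undual \<gamma>}"
      using lt by (intro psubset_card_mono) auto
    then have "(1 / 2 :: real) ^ card {..<undual \<gamma>} \<le> (1 / 2) ^ Suc (card {..<undual \<delta>})"
      by (intro power_decreasing) auto
    then show ?thesis using False lt by (simp add: real_of_level_dist_def)
  qed
qed

lemma real_of_level_dist_nonneg: "0 \<le> real_of_level_dist \<alpha> \<gamma>"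
  by (simp add: real_of_level_dist_def)

lemma real_of_level_dist_mono:
  assumes "is_omega \<alpha>" "\<gamma> \<in> level_dists \<alpha>" "\<delta> \<in> level_dists \<alpha>" "\<gamma> \<le> \<delta>"
  shows "real_of_level_dist \<alpha> \<gamma> \<le> real_of_level_dist \<alpha> \<delta>"
  using real_of_level_dist_halves[OF assms(1-3)] real_of_level_dist_nonneg[of \<alpha> \<delta>] assms(4)
  by (cases "\<gamma> = \<delta>") (auto simp: order_less_le)

lemma real_level_dist_eq_zero_iff:
  assumes "level_mapping L \<alpha> l" "I \<in> interpretations L" "J \<in> interpretations L"
  shows "real_level_dist L \<alpha> l I J = 0 \<longleftrightarrow> I = J"
proof -
  have "real_of_level_dist \<alpha> \<gamma> = 0 \<longleftrightarrow> \<gamma> = dual \<alpha>" for \<gamma>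
    by (cases \<gamma>) (simp add: real_of_level_dist_def)
  then show ?thesis using level_dist_eq_zero_iff[OF assms] by (simp add: real_level_dist_def)
qed

lemma ultrametric_real_level_dist:
  fixes L :: "('p, 'f) language" and l :: "('p, 'f, 'v) atom \<Rightarrow> 'o::wellorder"
  assumes om: "is_omega \<alpha>" and lm: "level_mapping L \<alpha> l"
  shows "ultrametric (interpretations L) (real_level_dist L \<alpha> l)"
proof -
  let ?d = "real_level_dist L \<alpha> l"
  have nonneg: "0 \<le> ?d I J" for I J by (simp add: real_level_dist_def real_of_level_dist_nonneg)
  have ultra: "?d I K \<le> max (?d I J) (?d J K)"
    if X: "I \<in> interpretations L" "J \<in> interpretations L" "K \<in> interpretations L" for I J K :: "('p, 'f, 'v) atom set"
  proof -
    have *: "?d I K \<le> real_of_level_dist \<alpha> \<gamma>"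
      if "level_dist L \<alpha> l I J \<le> \<gamma>" "level_dist L \<alpha> l J K \<le> \<gamma>" "\<gamma> \<in> level_dists \<alpha>" for \<gamma>
      using real_of_level_dist_mono[OF om level_dist_in_level_dists[OF lm X(1,3)] that(3)]
        level_dist_ultra[OF X that(3,1,2)] by (simp add: real_level_dist_def)
    \<comment> \<open>Levels are linearly ordered, so the larger of the two distances can serve as
      the common bound \<open>\<gamma>\<close> in \<open>*\<close>.\<close>
    have "level_dist L \<alpha> l I J \<le> level_dist L \<alpha> l J K
        \<or> level_dist L \<alpha> l J K \<le> level_dist L \<alpha> l I J"
      unfolding dual_less_eq_iff by (rule linear)
    then have "?d I K \<le> ?d I J \<or> ?d I K \<le> ?d J K"
      using *[OF order_refl _ level_dist_in_level_dists[OF lm X(1,2)]]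
        *[OF _ order_refl level_dist_in_level_dists[OF lm X(2,3)]]
      by (auto simp: real_level_dist_def)
    then show ?thesis by auto
  qed
  have "Metric_space (interpretations L) ?d"
  proof
    fix I J K :: "('p, 'f, 'v) atom set"
    assume "I \<in> interpretations L" "J \<in> interpretations L" "K \<in> interpretations L"
    then show "?d I K \<le> ?d I J + ?d J K"
      using ultra[of I J K] nonneg[of I J] nonneg[of J K] by linarith
  qed (use nonneg real_level_dist_eq_zero_iff[OF lm] level_dist_commute[of L \<alpha> l]
      in \<open>simp_all add: real_level_dist_def\<close>)
  then show ?thesis using ultra unfolding ultrametric_def by blast
qed

lemma contraction_real_level_dist:
  fixes L :: "('p, 'f) language" and l :: "('p, 'f, 'v) atom \<Rightarrow> 'o::wellorder"
  assumes om: "is_omega \<alpha>" and lm: "level_mapping L \<alpha> l"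
    and f: "strictly_contracting (interpretations L) (level_dist L \<alpha> l) f"
  shows "contraction (interpretations L) (real_level_dist L \<alpha> l) f"
  unfolding contraction_def
proof (intro conjI exI ballI)
  show fX: "f ` interpretations L \<subseteq> interpretations L"
    using f unfolding strictly_contracting_def by blast
  show "1 / 2 < (1 :: real)" by simp
  fix I J :: "('p, 'f, 'v) atom set"
  assume X: "I \<in> interpretations L" "J \<in> interpretations L"
  then have fIJ: "f I \<in> interpretations L" "f J \<in> interpretations L" using fX by blast+
  show "real_level_dist L \<alpha> l (f I) (f J) \<le> 1 / 2 * real_level_dist L \<alpha> l I J"
  \<comment> \<open>Strict contraction speaks only of distinct points; for equal ones both distances
    are 0.\<close>
  proof (cases "I = J")
    case True
    then show ?thesis
      using real_level_dist_eq_zero_iff[OF lm X] real_level_dist_eq_zero_iff[OF lm fIJ] by simp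
  next
    case False
    then have "level_dist L \<alpha> l (f I) (f J) < level_dist L \<alpha> l I J"
      using f X unfolding strictly_contracting_def by blast
    then show ?thesis unfolding real_level_dist_def
      by (intro real_of_level_dist_halves om level_dist_in_level_dists lm X fIJ)
  qed
qed

theorem theorem6:
  fixes L :: "('p, 'f) language"
    and P :: "('p, 'f, 'v) clause set"
    and \<alpha> :: "'o::wellorder"
    and l :: "('p, 'f, 'v) atom \<Rightarrow> 'o"
  assumes "normal_program L P"
    and "locally_stratified L P \<alpha> l"
  shows "generalized_ultrametric (interpretations L) (level_dists \<alpha>) (dual \<alpha>) (level_dist L \<alpha> l)
    \<and> spherically_complete (interpretations L) (level_dists \<alpha>) (level_dist L \<alpha> l)
    \<and> strictly_contracting (interpretations L) (level_dist L \<alpha> l) (GL L P)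
    \<and> (is_omega \<alpha> \<longrightarrow>
         ultrametric (interpretations L) (real_level_dist L \<alpha> l)
         \<and> contraction (interpretations L) (real_level_dist L \<alpha> l) (GL L P))
    \<and> (\<exists>!I. I \<in> interpretations L \<and> GL L P I = I)
    \<and> (\<exists>!M. stable_model L P M)"
proof -
  have lm: "level_mapping L \<alpha> l" using assms(2) unfolding locally_stratified_def by blast
  note um = generalized_ultrametric_level_dist[OF lm]
    and sc = spherically_complete_level_dist[of L \<alpha> l]
    and strict = strictly_contracting_GL[OF assms(2)]
  \<comment> \<open>The space is a power set, hence nonempty, so the fixed point theorem
    applies.\<close>
  have "\<exists>I\<in>interpretations L. GL L P I = I"
    by (rule strictly_contracting_has_fixed_point[OF um sc strict]) blast
  then have ex1: "\<exists>!I. I \<in> interpretations L \<and> GL L P I = I"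
    using strictly_contracting_fixed_point_unique[OF strict] by blast
  show ?thesis
    using um sc strict ex1 ultrametric_real_level_dist[OF _ lm]
      contraction_real_level_dist[OF _ lm strict]
    unfolding stable_model_def by blast
qed

end
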